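(* Let $g:\mathbb{R}\to\mathbb{R}$ be a bounded Borel function and let $\mu$ be a Radon measure on $\mathbb{R}$. Then for every $\varepsilon>0$ there exist a set $E\subset\mathbb{R}$ with $\mu(\mathbb{R}\setminus E)<\varepsilon$ and a $C^1$ function $f:\mathbb{R}\to\mathbb{R}$ such that $f'(x)=g(x)$ for every $x\in E$.
   Context: All sets and functions are assumed to be Borel measurable. Measures are defined on the Borel $\sigma$-algebra and are positive, locally finite and inner regular (the measure of a set can be approximated from within by compact subsets); the measure $\mu$ is not assumed to be finite. *)

theory Defs
  imports "HOL-Analysis.Analysis"
begin

definition radon_measure :: "'a::t2_space measure \<Rightarrow> bool" where
  "radon_measure M \<longleftrightarrow>
     sets M = sets borel \<and>
     (\<forall>x. \<exists>U. open U \<and> x \<in> U \<and> emeasure M U < \<infinity>) \<and>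
     (\<forall>A\<in>sets borel. emeasure M A = (SUP K\<in>{K. compact K \<and> K \<subseteq> A}. emeasure M K))"

end

theory Submission
  imports Defs
begin

text \<open>
  In dimension one the theorem reduces to Lusin's theorem, since every continuous function on the
  line has an antiderivative. Lusin's theorem yields a closed set \<open>E\<close>, with complement of measure
  less than \<open>\<epsilon>\<close>, on which \<open>g\<close> restricts to a continuous function; by Tietze's theorem this
  restriction extends to a continuous \<open>h\<close> on the whole line, and any antiderivative of \<open>h\<close> is a
  \<open>C\<^sup>1\<close> function whose derivative agrees with \<open>g\<close> on \<open>E\<close>.

  Lusin's theorem itself rests on outer regularity in the strong form
  \<open>radon_measure_outer_regular\<close>, where the excess \<open>U - A\<close> of an open set over a Borel set is small
  even if \<open>A\<close> has infinite measure. Given this, one replaces the preimages under \<open>g\<close> of countably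
  many basic open sets by slightly larger open sets; off the small union of the excesses, these
  preimages are relatively open, which is continuity.
\<close>

lemma emeasure_UN_geometric_le:
  assumes "range A \<subseteq> sets M" and "\<delta> \<ge> 0"
    and "\<And>n. emeasure M (A n) \<le> ennreal (\<delta> * (1/2) ^ Suc n)"
  shows "emeasure M (\<Union>n. A n) \<le> ennreal \<delta>"
proof -
  have "(\<lambda>n. \<delta> * (1/2) ^ Suc n) sums (\<delta> * 1)"
    by (intro sums_mult power_half_series)
  then have "(\<Sum>n. ennreal (\<delta> * (1/2) ^ Suc n)) = ennreal \<delta>"
    using assms(2) by (intro suminf_ennreal_eq) auto
  moreover have "emeasure M (\<Union>n. A n) \<le> (\<Sum>n. emeasure M (A n))"
    by (rule emeasure_subadditive_countably[OF assms(1)])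
  moreover have "\<dots> \<le> (\<Sum>n. ennreal (\<delta> * (1/2) ^ Suc n))"
    by (intro suminf_le assms(3)) auto
  ultimately show ?thesis by simp
qed

lemma radon_measure_inner_approx:
  fixes M :: "'a::t2_space measure"
  assumes "radon_measure M" and "A \<in> sets borel" and "emeasure M A < \<infinity>" and "\<delta> > 0"
  obtains K where "compact K" "K \<subseteq> A" "emeasure M (A - K) \<le> ennreal \<delta>"
proof -
  have sets: "sets M = sets borel"
    and sup: "emeasure M A = (SUP K\<in>{K. compact K \<and> K \<subseteq> A}. emeasure M K)"
    using assms(1,2) by (auto simp: radon_measure_def)
  have "{K. compact K \<and> K \<subseteq> A} \<noteq> {}" by auto
  then obtain K where K: "compact K" "K \<subseteq> A" "emeasure M A < emeasure M K + ennreal \<delta>"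
    using SUP_approx_ennreal[OF assms(4) _ sup] assms(3) by force
  have "K \<in> sets M" using K(1) sets by (auto intro: borel_compact)
  moreover have "emeasure M K < \<infinity>"
    using emeasure_mono[OF K(2), of M] assms(2,3) sets by auto
  ultimately have "emeasure M (A - K) = emeasure M A - emeasure M K"
    using K(2) assms(2) sets by (intro emeasure_Diff) auto
  also have "\<dots> \<le> ennreal \<delta>"
    using K(3) assms(3) by (auto simp: ennreal_minus_le_iff less_imp_le)
  finally show ?thesis using that K by blast
qed

text \<open>The complements, inside an open set \<open>C\<close> of finite measure, of compact sets that nearly exhaust
  \<open>C - A\<close> are open, because compact sets are closed. Countably many such sets \<open>C\<close> cover the space by
  the Lindelof property, and the union of these complements is the set sought.\<close>

lemma radon_measure_outer_regular:
  fixes M :: "'a::{t2_space,second_countable_topology} measure"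
  assumes M: "radon_measure M" and A: "A \<in> sets borel" and "\<delta> > 0"
  obtains U where "open U" "A \<subseteq> U" "emeasure M (U - A) \<le> ennreal \<delta>"
proof -
  have sets: "sets M = sets borel" using M by (simp add: radon_measure_def)
  define \<C> where "\<C> = {C. open C \<and> emeasure M C < \<infinity>}"
  have "\<Union>\<C> = UNIV"
    using M unfolding radon_measure_def \<C>_def by blast
  moreover obtain \<D> where "\<D> \<subseteq> \<C>" "countable \<D>" "\<Union>\<D> = \<Union>\<C>"
    using Lindelof[of \<C>] by (auto simp: \<C>_def)
  ultimately have \<D>: "\<D> \<subseteq> \<C>" "countable \<D>" "\<Union>\<D> = UNIV" "\<D> \<noteq> {}"
    by auto
  define C where "C = from_nat_into \<D>"
  have C: "open (C n)" "emeasure M (C n) < \<infinity>" for n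
    using from_nat_into[OF \<D>(4), of n] \<D>(1) by (auto simp: C_def \<C>_def)
  have cover: "(\<Union>n. C n) = UNIV"
    using range_from_nat_into[OF \<D>(4,2)] \<D>(3) by (simp add: C_def)
  have "\<exists>K. compact K \<and> K \<subseteq> C n - A \<and> emeasure M ((C n - A) - K) \<le> ennreal (\<delta> * (1/2) ^ Suc n)" for n
  proof -
    have fin: "emeasure M (C n - A) < \<infinity>"
      using emeasure_mono[of "C n - A" "C n" M] C[of n] sets by (auto simp: less_top[symmetric] top_unique)
    have meas: "C n - A \<in> sets borel" using A C(1)[of n] by auto
    have pos: "\<delta> * (1/2) ^ Suc n > 0" using \<open>\<delta> > 0\<close> by simp
    show ?thesis
      by (rule radon_measure_inner_approx[OF M meas fin pos]) (intro exI conjI)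
  qed
  then obtain K where K: "\<And>n. compact (K n)" "\<And>n. K n \<subseteq> C n - A"
    "\<And>n. emeasure M ((C n - A) - K n) \<le> ennreal (\<delta> * (1/2) ^ Suc n)"
    by metis
  define U where "U = (\<Union>n. C n - K n)"
  have meas: "range (\<lambda>n. (C n - A) - K n) \<subseteq> sets M"
    using sets A C(1) borel_compact[OF K(1)] by auto
  show ?thesis
  proof
    show "open U"
      unfolding U_def using C(1) K(1) by (intro open_UN ballI open_Diff compact_imp_closed) auto
    show "A \<subseteq> U"
      using cover K(2) unfolding U_def by blast
    have "U - A = (\<Union>n. (C n - A) - K n)"
      unfolding U_def by blast
    then show "emeasure M (U - A) \<le> ennreal \<delta>"
      using emeasure_UN_geometric_le[OF meas] \<open>\<delta> > 0\<close> K(3) by simp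
  qed
qed

text \<open>Lusin's theorem. Off the union \<open>N\<close> of the excesses \<open>U n - g -` B n\<close>, the preimage of the basic
  open set \<open>B n\<close> is cut out by the open set \<open>U n\<close>, so \<open>g\<close> is continuous there. The set \<open>E\<close> is the
  complement of an open neighbourhood of \<open>N\<close>, to make it closed.\<close>

theorem radon_measure_lusin:
  fixes M :: "'a::{t2_space,second_countable_topology} measure"
    and g :: "'a \<Rightarrow> 'b::second_countable_topology"
  assumes M: "radon_measure M" and g: "g \<in> borel_measurable borel" and "\<epsilon> > 0"
  obtains E where "closed E" "emeasure M (UNIV - E) < ennreal \<epsilon>" "continuous_on E g"
proof -
  have sets: "sets M = sets borel" using M by (simp add: radon_measure_def)
  \<comment> \<open>One share of the error is spent on \<open>N\<close>, one on enlarging it, and one gives strictness.\<close>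
  define \<delta> where "\<delta> = \<epsilon> / 3"
  have \<delta>: "\<delta> > 0" using \<open>\<epsilon> > 0\<close> by (simp add: \<delta>_def)
  obtain \<B> :: "'b set set" where \<B>: "countable \<B>" "topological_basis \<B>"
    using ex_countable_basis by blast
  have "\<B> \<noteq> {}"
    using topological_basisE[OF \<B>(2) open_UNIV UNIV_I] by blast
  define B where "B = from_nat_into \<B>"
  have rangeB: "range B = \<B>"
    using range_from_nat_into[OF \<open>\<B> \<noteq> {}\<close> \<B>(1)] by (simp add: B_def)
  have preB: "g -` B n \<in> sets borel" for n
    using measurable_sets[OF g, of "B n"] topological_basis_open[OF \<B>(2)] rangeB by auto
  have "\<exists>U. open U \<and> g -` B n \<subseteq> U \<and> emeasure M (U - g -` B n) \<le> ennreal (\<delta> * (1/2) ^ Suc n)" for n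
  proof -
    have pos: "\<delta> * (1/2) ^ Suc n > 0" using \<delta> by simp
    show ?thesis
      by (rule radon_measure_outer_regular[OF M preB pos]) (intro exI conjI)
  qed
  then obtain U where U: "\<And>n. open (U n)" "\<And>n. g -` B n \<subseteq> U n"
    "\<And>n. emeasure M (U n - g -` B n) \<le> ennreal (\<delta> * (1/2) ^ Suc n)"
    by metis
  define N where "N = (\<Union>n. U n - g -` B n)"
  have meas: "range (\<lambda>n. U n - g -` B n) \<subseteq> sets M"
    using sets U(1) preB by auto
  then have N: "N \<in> sets borel" using sets unfolding N_def by auto
  have N_small: "emeasure M N \<le> ennreal \<delta>"
    unfolding N_def using emeasure_UN_geometric_le[OF meas] \<delta> U(3) by simp
  obtain W where W: "open W" "N \<subseteq> W" "emeasure M (W - N) \<le> ennreal \<delta>"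
    using radon_measure_outer_regular[OF M N \<delta>] .
  show ?thesis
  proof
    show "closed (- W)" using W(1) by (simp add: closed_Compl)
    have "emeasure M (UNIV - - W) = emeasure M (N \<union> (W - N))"
      using W(2) by (simp add: Compl_eq_Diff_UNIV double_diff Un_absorb1)
    also have "\<dots> \<le> emeasure M N + emeasure M (W - N)"
      using N W(1) sets by (intro emeasure_subadditive) auto
    also have "\<dots> \<le> ennreal \<delta> + ennreal \<delta>"
      using N_small W(3) by (rule add_mono)
    also have "\<dots> < ennreal \<epsilon>"
      using \<delta> by (simp add: ennreal_plus[symmetric] ennreal_less_iff \<delta>_def del: ennreal_plus)
    finally show "emeasure M (UNIV - - W) < ennreal \<epsilon>" .
    show "continuous_on (- W) g"
      unfolding continuous_on_open_invariant
    proof (intro allI impI)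
      fix V :: "'b set" assume "open V"
      then obtain \<V> where \<V>: "\<V> \<subseteq> \<B>" "\<Union>\<V> = V"
        using \<B>(2) unfolding topological_basis_def by blast
      let ?J = "{n. B n \<in> \<V>}"
      have V: "V = (\<Union>n\<in>?J. B n)"
        using \<V> rangeB by blast
      have "U n \<inter> - W = g -` B n \<inter> - W" for n
        using U(2) W(2) unfolding N_def by blast
      then have "(\<Union>n\<in>?J. U n) \<inter> - W = g -` V \<inter> - W"
        unfolding V by blast
      moreover have "open (\<Union>n\<in>?J. U n)" using U(1) by blast
      ultimately show "\<exists>T. open T \<and> T \<inter> - W = g -` V \<inter> - W" by blast
    qed
  qed
qed

theorem theorem4p1:
  fixes g :: "real \<Rightarrow> real" and M :: "real measure" and \<epsilon> :: real
  assumes "g \<in> borel_measurable borel"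
    and "bounded (range g)"
    and "radon_measure M"
    and "\<epsilon> > 0"
  shows "\<exists>E f. E \<in> sets borel \<and> emeasure M (UNIV - E) < ennreal \<epsilon> \<and>
           f C1_differentiable_on UNIV \<and>
           (\<forall>x\<in>E. (f has_real_derivative g x) (at x))"
proof -
  obtain E where E: "closed E" "emeasure M (UNIV - E) < ennreal \<epsilon>" "continuous_on E g"
    using radon_measure_lusin[OF assms(3,1,4)] .
  obtain h where h: "continuous_on UNIV h" "\<And>x. x \<in> E \<Longrightarrow> h x = g x"
    using Tietze_unbounded[OF E(3), of UNIV] E(1) by auto
  have "isCont h x" for x
    using h(1) by (simp add: continuous_on_eq_continuous_at)
  then obtain f where f: "\<And>x. (f has_vector_derivative h x) (at x)"
    using einterval_antiderivative[of "-\<infinity>" "\<infinity>" h] by auto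
  have "f C1_differentiable_on UNIV"
    unfolding C1_differentiable_on_def using f h(1) by blast
  moreover have "\<forall>x\<in>E. (f has_real_derivative g x) (at x)"
    using f h(2) by (metis has_real_derivative_iff_has_vector_derivative)
  ultimately show ?thesis
    using borel_closed[OF E(1)] E(2) by (intro exI conjI)
qed

end
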